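(* Consider the adjacency-list model augmented with $\texttt{JUMP}$, $\texttt{IN-SORTED}$ and $\texttt{ADJ}$. For any $n$ and $m$ with $n\le m\le n^2$, there exists a directed graph $G=(V,E)$ with $\Theta(n)$ nodes and $\Theta(m)$ edges such that for any algorithm solving the single-node problem, the expected running time on $G$, averaged over all targets $t\in V$, is $\Omega\big(\min\{m^{1/2},n^{2/3}\}\big)$.
   Context: Fix a constant $\alpha\in(0,1)$. For a directed graph $G=(V,E)$ with $n=|V|$, an $\alpha$-discounted random walk from $s$: at each step, with probability $\alpha$ it terminates at the current node, otherwise it moves to a uniformly random out-neighbor of the current node. $\pi(s,t)$ is the probability that such a walk from $s$ terminates at $t$, and $\pi(t)=\frac1n\sum_{s\in V}\pi(s,t)$. Adjacency-list model: an algorithm accesses $G$ only through constant-time queries $\texttt{DEG-IN}(u)$, $\texttt{DEG-OUT}(u)$ (in-/out-degree of $u$), $\texttt{IN}(u,i)$, $\texttt{OUT}(u,i)$ ($i$-th in-/out-neighbor of $u$). Additional queries: $\texttt{ADJ}(u,v)$ returns whether $(u,v)\in E$; $\texttt{IN-SORTED}(u,i)$ returns the $i$-th in-neighbor of $u$ when in-neighbors are sorted by out-degree; $\texttt{JUMP}()$ returns a uniformly random node of $V$. Single-node problem: given $G$ (via queries) and a target $t\in V$, output $\hat\pi(t)$ with $\Pr\{|\hat\pi(t)-\pi(t)|\ge\varepsilon\pi(t)\}\le p_f$, where $\varepsilon,p_f$ are fixed small constants; an algorithm solves the problem if this holds for every input. *)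

theory Defs
  imports "HOL-Probability.Probability" "Graph_Theory.Pair_Digraph"
begin

text \<open>
  Input graphs are finite digraphs \<open>E \<subseteq> V \<times> V\<close> in which every node has an out-neighbour,
  so that the random walk is always able to move.
\<close>

definition walkable :: "'a pair_pre_digraph \<Rightarrow> bool" where
  "walkable G \<longleftrightarrow> pair_fin_digraph G \<and> (\<forall>u\<in>pverts G. out_degree G u \<ge> 1)"

definition out_nbrs :: "'a pair_pre_digraph \<Rightarrow> 'a \<Rightarrow> 'a set" where
  "out_nbrs G u = parcs G `` {u}"

definition in_nbrs :: "'a pair_pre_digraph \<Rightarrow> 'a \<Rightarrow> 'a set" where
  "in_nbrs G u = (parcs G)\<inverse> `` {u}"


partial_function (spmf) walk_end :: "real \<Rightarrow> 'a pair_pre_digraph \<Rightarrow> 'a \<Rightarrow> 'a spmf" where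
  "walk_end \<alpha> G u =
     bind_spmf (spmf_of_pmf (bernoulli_pmf \<alpha>))
       (\<lambda>stop. if stop then return_spmf u
               else bind_spmf (spmf_of_set (out_nbrs G u)) (walk_end \<alpha> G))"

definition ppr :: "real \<Rightarrow> 'a pair_pre_digraph \<Rightarrow> 'a \<Rightarrow> 'a \<Rightarrow> real" where
  "ppr \<alpha> G s t = spmf (walk_end \<alpha> G s) t"

definition pagerank :: "real \<Rightarrow> 'a pair_pre_digraph \<Rightarrow> 'a \<Rightarrow> real" where
  "pagerank \<alpha> G t = (\<Sum>s\<in>pverts G. ppr \<alpha> G s t) / real (card (pverts G))"


text \<open>
  The enumeration orders used for replies to queries are part of the input. The order of \<open>in_sorted_list\<close>
  is only determined up to ties between in-neighbours of equal out-degree.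
\<close>

record adj_lists =
  out_list :: "nat \<Rightarrow> nat list"
  in_list :: "nat \<Rightarrow> nat list"
  in_sorted_list :: "nat \<Rightarrow> nat list"

definition adj_lists_of :: "nat pair_pre_digraph \<Rightarrow> adj_lists \<Rightarrow> bool" where
  "adj_lists_of G L \<longleftrightarrow> (\<forall>u\<in>pverts G.
     distinct (out_list L u) \<and> set (out_list L u) = out_nbrs G u \<and>
     distinct (in_list L u) \<and> set (in_list L u) = in_nbrs G u \<and>
     distinct (in_sorted_list L u) \<and> set (in_sorted_list L u) = in_nbrs G u \<and>
     sorted (map (out_degree G) (in_sorted_list L u)))"

datatype query =
    Deg_In nat | Deg_Out nat | In nat nat | Out nat nat
  | Adj nat nat | In_Sorted nat nat | Jump

datatype answer = Number nat | Node nat | Truth bool | Invalid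

text \<open>Neighbours are numbered from \<open>0\<close>; ill-formed queries are answered by \<open>Invalid\<close>.\<close>

definition nth_answer :: "nat list \<Rightarrow> nat \<Rightarrow> answer" where
  "nth_answer xs i = (if i < length xs then Node (xs ! i) else Invalid)"

fun reply :: "nat pair_pre_digraph \<Rightarrow> adj_lists \<Rightarrow> query \<Rightarrow> answer pmf" where
  "reply G L (Deg_In u) =
     return_pmf (if u \<in> pverts G then Number (in_degree G u) else Invalid)"
| "reply G L (Deg_Out u) =
     return_pmf (if u \<in> pverts G then Number (out_degree G u) else Invalid)"
| "reply G L (In u i) =
     return_pmf (if u \<in> pverts G then nth_answer (in_list L u) i else Invalid)"
| "reply G L (Out u i) =
     return_pmf (if u \<in> pverts G then nth_answer (out_list L u) i else Invalid)"
| "reply G L (Adj u v) =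
     return_pmf (if u \<in> pverts G \<and> v \<in> pverts G then Truth ((u, v) \<in> parcs G) else Invalid)"
| "reply G L (In_Sorted u i) =
     return_pmf (if u \<in> pverts G then nth_answer (in_sorted_list L u) i else Invalid)"
| "reply G L Jump = map_pmf Node (pmf_of_set (pverts G))"


text \<open>
  An algorithm is a randomized machine whose memory content is encoded as a natural number,
  initially \<open>0\<close>. From the number of nodes, the target and its memory it draws the next unit-time
  action: a query (the new memory being a function of the answer), a local computation
  replacing the memory, or halting with an output. What can be computed locally in one step is not
  restricted.
\<close>

datatype action = Ask query "answer \<Rightarrow> nat" | Compute nat | Halt real

type_synonym algorithm = "nat \<Rightarrow> nat \<Rightarrow> nat \<Rightarrow> action pmf"

datatype config = Running nat | Halted real

fun step :: "nat pair_pre_digraph \<Rightarrow> adj_lists \<Rightarrow> algorithm \<Rightarrow> nat \<Rightarrow> config \<Rightarrow> config pmf" where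
  "step G L A t (Halted x) = return_pmf (Halted x)"
| "step G L A t (Running s) =
     bind_pmf (A (card (pverts G)) t s)
       (\<lambda>a. case a of
              Ask q f \<Rightarrow> map_pmf (\<lambda>r. Running (f r)) (reply G L q)
            | Compute s' \<Rightarrow> return_pmf (Running s')
            | Halt x \<Rightarrow> return_pmf (Halted x))"

primrec run :: "nat pair_pre_digraph \<Rightarrow> adj_lists \<Rightarrow> algorithm \<Rightarrow> nat \<Rightarrow> nat \<Rightarrow> config pmf" where
  "run G L A t 0 = return_pmf (Running 0)"
| "run G L A t (Suc k) = bind_pmf (run G L A t k) (step G L A t)"

text \<open>
  The events that the output lies in \<open>S\<close> and was produced within \<open>k\<close> steps increase with \<open>k\<close>,
  so the supremum is the probability that an output in \<open>S\<close> is ever produced.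
\<close>

definition output_prob ::
  "nat pair_pre_digraph \<Rightarrow> adj_lists \<Rightarrow> algorithm \<Rightarrow> nat \<Rightarrow> real set \<Rightarrow> real" where
  "output_prob G L A t S = (SUP k. measure_pmf.prob (run G L A t k) (Halted ` S))"

text \<open>
  The expected number of steps \<open>T\<close> (the halting step included), as the sum of the tail
  probabilities \<open>P(T > k)\<close>; it is infinite if the machine runs forever with positive probability.
\<close>

definition expected_time ::
  "nat pair_pre_digraph \<Rightarrow> adj_lists \<Rightarrow> algorithm \<Rightarrow> nat \<Rightarrow> ennreal" where
  "expected_time G L A t =
     (\<Sum>k. ennreal (measure_pmf.prob (run G L A t k) (range Running)))"

definition average_expected_time ::
  "nat pair_pre_digraph \<Rightarrow> adj_lists \<Rightarrow> algorithm \<Rightarrow> ennreal" where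
  "average_expected_time G L A =
     (\<Sum>t\<in>pverts G. expected_time G L A t) / of_nat (card (pverts G))"

text \<open>Running forever counts as a failure.\<close>

definition solves_single_node :: "real \<Rightarrow> real \<Rightarrow> real \<Rightarrow> algorithm \<Rightarrow> bool" where
  "solves_single_node \<alpha> \<epsilon> p\<^sub>f A \<longleftrightarrow>
     (\<forall>G L. walkable G \<longrightarrow> adj_lists_of G L \<longrightarrow>
        (\<forall>t\<in>pverts G.
           1 - output_prob G L A t {x. \<not> \<bar>x - pagerank \<alpha> G t\<bar> \<ge> \<epsilon> * pagerank \<alpha> G t} \<le> p\<^sub>f))"

end

theory Submission
  imports Defs "HOL-Combinatorics.Transposition" "HOL-Library.Discrete_Functions"
begin

text \<open>
  Since the algorithm may know the instance \<open>G\<close> by heart, it only has to certify that its input is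
  \<open>G\<close>. Replacing two arcs \<open>(z, y)\<close>, \<open>(u, x)\<close> by \<open>(z, x)\<close>, \<open>(u, y)\<close>, where \<open>z\<close> and \<open>u\<close> have the same
  out-degree, preserves all degrees and changes the answers only to queries that probe one of the
  pairs in \<open>{z, u} \<times> {x, y}\<close>. If a switch changes the PageRank of \<open>t\<close> by a large constant factor,
  then on input \<open>G\<close> such a query must be asked with probability at least \<open>1 - 2 p\<^sub>f\<close>. So a family
  of \<open>K\<close> such switches in which every pair is probed by at most \<open>r\<close> of them forces an expected
  number of \<open>(1 - 2 p\<^sub>f) K / r\<close> queries.

  In the hard instance every target has \<open>k e\<close> arcs two levels above it, each of which may be
  switched with one of the \<open>k e\<close> arcs leaving a node of large PageRank; here \<open>K = (k e)\<^sup>2\<close> and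
  \<open>r = 4 k e\<close>. The sizes satisfy \<open>e \<le> k\<close> and \<open>k\<^sup>2 e \<approx> n\<close>, and \<open>k e\<close> is of order
  \<open>min (m\<^bsup>1/2\<^esup>) (n\<^bsup>2/3\<^esup>)\<close>.
\<close>

section \<open>Degrees and finiteness of neighbourhoods\<close>

lemma out_degree_eq_card_out_nbrs: "out_degree (with_proj G) u = card (out_nbrs G u)"
proof -
  have "out_arcs (with_proj G) u = Pair u ` out_nbrs G u"
    by (auto simp: out_arcs_def out_nbrs_def)
  then show ?thesis
    by (simp add: out_degree_def card_image inj_on_def)
qed

lemma in_degree_eq_card_in_nbrs: "in_degree (with_proj G) u = card (in_nbrs G u)"
proof -
  have "in_arcs (with_proj G) u = (\<lambda>v. (v, u)) ` in_nbrs G u"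
    by (auto simp: in_arcs_def in_nbrs_def)
  then show ?thesis
    by (simp add: in_degree_def card_image inj_on_def)
qed

lemma finite_out_nbrs: "walkable G \<Longrightarrow> finite (out_nbrs G u)"
  by (auto simp: walkable_def out_nbrs_def pair_fin_digraph_def pair_fin_digraph_axioms_def)

lemma out_nbrs_nonempty: "walkable G \<Longrightarrow> u \<in> pverts G \<Longrightarrow> out_nbrs G u \<noteq> {}"
  by (auto simp: walkable_def out_degree_eq_card_out_nbrs)

lemma finite_pverts: "walkable G \<Longrightarrow> finite (pverts G)"
  by (simp add: walkable_def pair_fin_digraph_def pair_fin_digraph_axioms_def)

section \<open>First-step analysis of personalized PageRank\<close>

text \<open>Condition on the first coin flip and, if the walk goes on, on its first move. The
  out-neighbourhood is finite and nonempty, so the uniform choice loses no mass and the integral is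
  a plain average.\<close>

lemma ppr_step:
  assumes "walkable G" "u \<in> pverts G" "0 < \<alpha>" "\<alpha> < 1"
  shows "ppr \<alpha> G u t = (if u = t then \<alpha> else 0) +
    (1 - \<alpha>) * ((\<Sum>v\<in>out_nbrs G u. ppr \<alpha> G v t) / real (card (out_nbrs G u)))"
proof -
  let ?N = "out_nbrs G u"
  have N: "finite ?N" "?N \<noteq> {}"
    using assms by (simp_all add: finite_out_nbrs out_nbrs_nonempty)
  have "bind_spmf (spmf_of_set ?N) (walk_end \<alpha> G) = bind_pmf (pmf_of_set ?N) (walk_end \<alpha> G)"
    using N by (simp flip: spmf_of_pmf_pmf_of_set)
  then have "spmf (bind_spmf (spmf_of_set ?N) (walk_end \<alpha> G)) t
      = (\<Sum>v\<in>?N. ppr \<alpha> G v t) / real (card ?N)"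
    using N by (simp add: pmf_bind integral_pmf_of_set ppr_def)
  then show ?thesis
    unfolding ppr_def
    by (subst walk_end.simps) (use assms in \<open>simp add: pmf_bind algebra_simps\<close>)
qed

lemma ppr_nonneg: "0 \<le> ppr \<alpha> G u t"
  by (simp add: ppr_def)

text \<open>The first-step equation reads
  \<open>x = \<alpha> * [u = t] + (1 - \<alpha>) * x\<close>; cancelling \<alpha> solves it.\<close>

lemma ppr_loop:
  assumes "walkable G" "u \<in> pverts G" "0 < \<alpha>" "\<alpha> < 1" "out_nbrs G u = {u}"
  shows "ppr \<alpha> G u t = (if u = t then 1 else 0)"
proof -
  have "\<alpha> * ppr \<alpha> G u t = \<alpha> * (if u = t then 1 else 0)"
    using ppr_step[OF assms(1-4), of t] assms(5) by (simp add: algebra_simps split: if_splits)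
  then show ?thesis
    using \<open>0 < \<alpha>\<close> by simp
qed

text \<open>Gives exact values in the hard instance, where at most one out-neighbour of a hub, spoke
  or leaf leads to the target.\<close>

lemma ppr_single_out_nbr:
  assumes "walkable G" "u \<in> pverts G" "0 < \<alpha>" "\<alpha> < 1" "u \<noteq> t"
    and "v \<in> out_nbrs G u" "\<And>w. w \<in> out_nbrs G u \<Longrightarrow> w \<noteq> v \<Longrightarrow> ppr \<alpha> G w t = 0"
  shows "ppr \<alpha> G u t = (1 - \<alpha>) * ppr \<alpha> G v t / real (card (out_nbrs G u))"
proof -
  have "(\<Sum>w\<in>out_nbrs G u. ppr \<alpha> G w t) = (\<Sum>w\<in>{v}. ppr \<alpha> G w t)"
    using assms(6,7) finite_out_nbrs[OF assms(1)] by (intro sum.mono_neutral_right) auto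
  then show ?thesis
    using ppr_step[OF assms(1-4), of t] \<open>u \<noteq> t\<close> by simp
qed

lemma ppr_eq_0:
  assumes "walkable G" "u \<in> pverts G" "0 < \<alpha>" "\<alpha> < 1" "u \<noteq> t"
    and "\<And>w. w \<in> out_nbrs G u \<Longrightarrow> ppr \<alpha> G w t = 0"
  shows "ppr \<alpha> G u t = 0"
  using ppr_step[OF assms(1-4), of t] assms(5,6) by simp

text \<open>Keeps a single summand of the first-step equation. After a switch only a lower bound
  along one path is required.\<close>

lemma ppr_ge_out_nbr:
  assumes "walkable G" "u \<in> pverts G" "0 < \<alpha>" "\<alpha> < 1" "v \<in> out_nbrs G u"
  shows "(1 - \<alpha>) * ppr \<alpha> G v t / real (card (out_nbrs G u)) \<le> ppr \<alpha> G u t"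
proof -
  have "ppr \<alpha> G v t \<le> (\<Sum>w\<in>out_nbrs G u. ppr \<alpha> G w t)"
    using assms finite_out_nbrs by (intro member_le_sum) (auto simp: ppr_nonneg)
  then have "(1 - \<alpha>) * (ppr \<alpha> G v t / real (card (out_nbrs G u)))
    \<le> (1 - \<alpha>) * ((\<Sum>w\<in>out_nbrs G u. ppr \<alpha> G w t) / real (card (out_nbrs G u)))"
    using assms by (intro mult_left_mono divide_right_mono) auto
  then show ?thesis
    using ppr_step[OF assms(1-4), of t] \<open>0 < \<alpha>\<close> by (simp split: if_splits)
qed

section \<open>Distinguishing two inputs\<close>

definition ask_prob :: "nat \<Rightarrow> algorithm \<Rightarrow> nat \<Rightarrow> query set \<Rightarrow> config \<Rightarrow> ennreal" where
  "ask_prob N A t D c = (case c of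
     Running s \<Rightarrow> (\<integral>\<^sup>+a. of_bool (\<exists>q\<in>D. \<exists>f. a = Ask q f) \<partial>A N t s)
   | Halted x \<Rightarrow> 0)"

text \<open>For one \<open>i\<close> this is the probability that the action taken after
  \<open>i\<close> steps is a query from \<open>D\<close>; summed over \<open>i\<close> it is the
  expected number of such queries.\<close>

definition expected_asks ::
  "nat pair_pre_digraph \<Rightarrow> adj_lists \<Rightarrow> algorithm \<Rightarrow> nat \<Rightarrow> query set \<Rightarrow> nat \<Rightarrow> ennreal" where
  "expected_asks G L A t D i = (\<integral>\<^sup>+c. ask_prob (card (pverts G)) A t D c \<partial>run G L A t i)"

text \<open>Both machines draw their action from the same distribution, since they see the same node
  count. Unless the action is a query from \<open>D\<close>, the next configurations agree in law;
  otherwise the expectations of \<open>f\<close> differ by at most 1.\<close>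

lemma step_perturbation:
  fixes f :: "config \<Rightarrow> ennreal"
  assumes "card (pverts G') = card (pverts G)"
    and "\<And>q. q \<notin> D \<Longrightarrow> reply G' L' q = reply G L q"
    and "\<And>c. f c \<le> 1"
  shows "(\<integral>\<^sup>+c. f c \<partial>step G' L' A t x)
    \<le> (\<integral>\<^sup>+c. f c \<partial>step G L A t x) + ask_prob (card (pverts G)) A t D x"
proof (cases x)
  case (Running s)
  define next_config where "next_config G L a = (case a of
              Ask q f \<Rightarrow> map_pmf (\<lambda>r. Running (f r)) (reply G L q)
            | Compute s' \<Rightarrow> return_pmf (Running s')
            | Halt x \<Rightarrow> return_pmf (Halted x))" for G L a
  have le1: "(\<integral>\<^sup>+c. f c \<partial>measure_pmf p) \<le> 1" for p
    using nn_integral_mono[of "measure_pmf p" f "\<lambda>_. 1"] assms(3) by simp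
  have pw: "(\<integral>\<^sup>+c. f c \<partial>next_config G' L' a)
      \<le> (\<integral>\<^sup>+c. f c \<partial>next_config G L a) + of_bool (\<exists>q\<in>D. \<exists>f. a = Ask q f)" for a
  proof (cases "\<exists>q\<in>D. \<exists>f. a = Ask q f")
    case True
    then show ?thesis
      using le1 by (simp add: add_increasing)
  next
    case False
    then have "next_config G' L' a = next_config G L a"
      using assms(2) by (auto simp: next_config_def split: action.split)
    then show ?thesis by simp
  qed
  have "(\<integral>\<^sup>+c. f c \<partial>step G' L' A t x)
      = (\<integral>\<^sup>+a. \<integral>\<^sup>+c. f c \<partial>next_config G' L' a \<partial>A (card (pverts G)) t s)"
    using Running assms(1) by (simp add: next_config_def)
  also have "\<dots> \<le> (\<integral>\<^sup>+a. (\<integral>\<^sup>+c. f c \<partial>next_config G L a)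
      + of_bool (\<exists>q\<in>D. \<exists>f. a = Ask q f) \<partial>A (card (pverts G)) t s)"
    by (intro nn_integral_mono pw)
  also have "\<dots> = (\<integral>\<^sup>+c. f c \<partial>step G L A t x) + ask_prob (card (pverts G)) A t D x"
    using Running by (simp add: nn_integral_add next_config_def ask_prob_def)
  finally show ?thesis .
qed (simp add: ask_prob_def)

text \<open>A hybrid argument: the last step on \<open>G'\<close> is absorbed into the test function
  \<open>g\<close>, which is again bounded by 1, so \<open>f\<close> must vary in the induction. All
  queries from \<open>D\<close> are charged to the run on \<open>G\<close>.\<close>

lemma run_perturbation:
  fixes f :: "config \<Rightarrow> ennreal"
  assumes "card (pverts G') = card (pverts G)"
    and "\<And>q. q \<notin> D \<Longrightarrow> reply G' L' q = reply G L q"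
    and "\<And>c. f c \<le> 1"
  shows "(\<integral>\<^sup>+c. f c \<partial>run G' L' A t k)
    \<le> (\<integral>\<^sup>+c. f c \<partial>run G L A t k) + (\<Sum>i<k. expected_asks G L A t D i)"
  using assms(3)
proof (induction k arbitrary: f)
  case (Suc k)
  define g where "g x = (\<integral>\<^sup>+c. f c \<partial>step G' L' A t x)" for x
  have g: "g x \<le> 1" for x
    using nn_integral_mono[of "step G' L' A t x" f "\<lambda>_. 1"] Suc.prems by (simp add: g_def)
  have "(\<integral>\<^sup>+c. f c \<partial>run G' L' A t (Suc k)) = (\<integral>\<^sup>+x. g x \<partial>run G' L' A t k)"
    by (simp add: g_def)
  also have "\<dots> \<le> (\<integral>\<^sup>+x. g x \<partial>run G L A t k) + (\<Sum>i<k. expected_asks G L A t D i)"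
    by (rule Suc.IH[OF g])
  also have "(\<integral>\<^sup>+x. g x \<partial>run G L A t k)
      \<le> (\<integral>\<^sup>+x. (\<integral>\<^sup>+c. f c \<partial>step G L A t x)
          + ask_prob (card (pverts G)) A t D x \<partial>run G L A t k)"
    unfolding g_def by (intro nn_integral_mono step_perturbation assms(1,2) Suc.prems)
  also have "\<dots> = (\<integral>\<^sup>+c. f c \<partial>run G L A t (Suc k)) + expected_asks G L A t D k"
    by (simp add: nn_integral_add expected_asks_def)
  finally show ?case
    by (simp add: add_ac)
qed simp

lemma prob_eq_nn_integral_of_bool:
  "ennreal (measure_pmf.prob p S) = (\<integral>\<^sup>+c. of_bool (c \<in> S) \<partial>measure_pmf p)"
proof -
  have "(\<integral>\<^sup>+c. of_bool (c \<in> S) \<partial>measure_pmf p) = (\<integral>\<^sup>+c. indicator S c \<partial>measure_pmf p)"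
    by (intro nn_integral_cong) (simp add: indicator_def)
  then show ?thesis
    by (simp add: measure_pmf.emeasure_eq_measure)
qed

text \<open>Halted configurations are absorbing.\<close>

lemma incseq_halted_prob: "incseq (\<lambda>k. measure_pmf.prob (run G L A t k) (Halted ` S))"
proof (rule incseq_SucI)
  fix k
  have "of_bool (c \<in> Halted ` S) \<le> (\<integral>\<^sup>+c. of_bool (c \<in> Halted ` S) \<partial>step G L A t c)" for c
    by (cases c) auto
  then have "ennreal (measure_pmf.prob (run G L A t k) (Halted ` S))
      \<le> ennreal (measure_pmf.prob (run G L A t (Suc k)) (Halted ` S))"
    unfolding prob_eq_nn_integral_of_bool by (auto intro: nn_integral_mono)
  then show "measure_pmf.prob (run G L A t k) (Halted ` S)
      \<le> measure_pmf.prob (run G L A t (Suc k)) (Halted ` S)"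
    by simp
qed

lemma halted_prob_tendsto_output_prob:
  "(\<lambda>k. measure_pmf.prob (run G L A t k) (Halted ` S)) \<longlonglongrightarrow> output_prob G L A t S"
  unfolding output_prob_def
  by (rule LIMSEQ_incseq_SUP[OF _ incseq_halted_prob])
    (auto intro!: bdd_aboveI[of _ 1])

text \<open>On \<open>G\<close>, outputs in \<open>S'\<close> have probability at most 1 minus that
  of \<open>S\<close>. Any excess of \<open>S'\<close> on \<open>G'\<close> is paid for by queries
  from \<open>D\<close>. This is shown for each number of steps, then in the limit.\<close>

lemma output_prob_perturbation:
  assumes "card (pverts G') = card (pverts G)"
    and "\<And>q. q \<notin> D \<Longrightarrow> reply G' L' q = reply G L q"
    and "S \<inter> S' = {}"
  shows "ennreal (output_prob G L A t S + output_prob G' L' A t S' - 1)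
    \<le> (\<Sum>i. expected_asks G L A t D i)"
proof (rule LIMSEQ_le_const2)
  show "(\<lambda>k. ennreal (measure_pmf.prob (run G L A t k) (Halted ` S)
      + measure_pmf.prob (run G' L' A t k) (Halted ` S') - 1))
    \<longlonglongrightarrow> ennreal (output_prob G L A t S + output_prob G' L' A t S' - 1)"
    by (intro tendsto_ennrealI tendsto_intros halted_prob_tendsto_output_prob)
  have "ennreal (measure_pmf.prob (run G L A t k) (Halted ` S)
      + measure_pmf.prob (run G' L' A t k) (Halted ` S') - 1)
      \<le> (\<Sum>i. expected_asks G L A t D i)" for k
  proof -
    let ?p = "measure_pmf.prob (run G L A t k)"
    let ?x = "?p (Halted ` S)" and ?y = "?p (Halted ` S')"
    let ?z = "measure_pmf.prob (run G' L' A t k) (Halted ` S')"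
    let ?E = "\<Sum>i<k. expected_asks G L A t D i"
    have "?x + ?y = ?p (Halted ` S \<union> Halted ` S')"
      using assms(3) by (subst measure_pmf.finite_measure_Union) auto
    then have xy: "?x + ?y \<le> 1"
      by simp
    have "ennreal ?z \<le> ennreal ?y + ?E"
      unfolding prob_eq_nn_integral_of_bool
      by (rule run_perturbation[OF assms(1,2)]) auto
    then have "ennreal (?z - ?y) \<le> ?E"
      by (subst ennreal_minus[symmetric]) (simp_all add: ennreal_minus_le_iff)
    moreover have "ennreal (?x + ?z - 1) \<le> ennreal (?z - ?y)"
      using xy by (intro ennreal_leI) simp
    moreover have "?E \<le> (\<Sum>i. expected_asks G L A t D i)"
      by (rule sum_le_suminf) auto
    ultimately show ?thesis
      by (meson order_trans)
  qed
  then show "\<exists>N. \<forall>k\<ge>N. ennreal (measure_pmf.prob (run G L A t k) (Halted ` S)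
      + measure_pmf.prob (run G' L' A t k) (Halted ` S') - 1)
      \<le> (\<Sum>i. expected_asks G L A t D i)"
    by blast
qed

text \<open>Double counting: each step asks at most one query, which lies in at most
  \<open>r\<close> of the sets, and the probabilities of still running add up to the expected
  time.\<close>

lemma sum_expected_asks_le:
  assumes "finite I" and "\<And>q. card {M\<in>I. q \<in> D M} \<le> r"
  shows "(\<Sum>M\<in>I. \<Sum>i. expected_asks G L A t (D M) i) \<le> of_nat r * expected_time G L A t"
proof -
  have asks: "(\<Sum>M\<in>I. ask_prob N A t (D M) c) \<le> of_nat r * of_bool (c \<in> range Running)" for N c
  proof (cases c)
    case (Running s)
    have "(\<Sum>M\<in>I. of_bool (\<exists>q\<in>D M. \<exists>f. a = Ask q f)) \<le> (of_nat r :: ennreal)" for a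
    proof (cases a)
      case (Ask q f)
      have "(\<Sum>M\<in>I. of_bool (\<exists>q\<in>D M. \<exists>f. a = Ask q f)) = (of_nat (card {M\<in>I. q \<in> D M}) :: ennreal)"
        using assms(1) Ask by (simp add: of_bool_def sum.If_cases Int_def)
      then show ?thesis
        using assms(2)[of q] by (simp)
    qed (use assms(1) in auto)
    then have "(\<integral>\<^sup>+a. (\<Sum>M\<in>I. of_bool (\<exists>q\<in>D M. \<exists>f. a = Ask q f)) \<partial>A N t s)
        \<le> (\<integral>\<^sup>+a. of_nat r \<partial>A N t s)"
      by (intro nn_integral_mono)
    then show ?thesis
      using Running by (simp add: ask_prob_def nn_integral_sum)
  qed (simp add: ask_prob_def)
  have "(\<Sum>M\<in>I. \<Sum>i. expected_asks G L A t (D M) i)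
      = (\<Sum>i. \<Sum>M\<in>I. expected_asks G L A t (D M) i)"
    by (intro suminf_sum[symmetric]) auto
  also have "\<dots> \<le> (\<Sum>i. of_nat r * ennreal (measure_pmf.prob (run G L A t i) (range Running)))"
  proof (intro suminf_le)
    fix i
    have "(\<Sum>M\<in>I. expected_asks G L A t (D M) i)
        = (\<integral>\<^sup>+c. (\<Sum>M\<in>I. ask_prob (card (pverts G)) A t (D M) c) \<partial>run G L A t i)"
      by (simp add: expected_asks_def nn_integral_sum)
    also have "\<dots> \<le> (\<integral>\<^sup>+c. of_nat r * of_bool (c \<in> range Running) \<partial>run G L A t i)"
      by (intro nn_integral_mono asks)
    also have "\<dots> = of_nat r * ennreal (measure_pmf.prob (run G L A t i) (range Running))"
      by (simp add: nn_integral_cmult prob_eq_nn_integral_of_bool)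
    finally show "(\<Sum>M\<in>I. expected_asks G L A t (D M) i)
        \<le> of_nat r * ennreal (measure_pmf.prob (run G L A t i) (range Running))" .
  qed auto
  also have "\<dots> = of_nat r * expected_time G L A t"
    by (simp add: expected_time_def)
  finally show ?thesis .
qed

text \<open>Correctness on both \<open>G\<close> and \<open>G' M\<close> makes the two output
  probabilities at least \<open>1 - p\<^sub>f\<close> each, so every \<open>M\<close> contributes
  \<open>1 - 2 * p\<^sub>f\<close> to the double count.\<close>

lemma expected_time_ge_of_distinguishable:
  assumes "solves_single_node \<alpha> \<epsilon> p\<^sub>f A" "walkable G" "adj_lists_of G L" "t \<in> pverts G"
    and "finite I" and "\<And>q. card {M\<in>I. q \<in> D M} \<le> r"
    and "\<And>M. M \<in> I \<Longrightarrow> walkable (G' M)" "\<And>M. M \<in> I \<Longrightarrow> adj_lists_of (G' M) (L' M)"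
    and "\<And>M. M \<in> I \<Longrightarrow> pverts (G' M) = pverts G"
    and "\<And>M q. M \<in> I \<Longrightarrow> q \<notin> D M \<Longrightarrow> reply (G' M) (L' M) q = reply G L q"
    and "\<And>M. M \<in> I \<Longrightarrow> (1 + \<epsilon>) * pagerank \<alpha> G t \<le> (1 - \<epsilon>) * pagerank \<alpha> (G' M) t"
  shows "of_nat (card I) * ennreal (1 - 2 * p\<^sub>f) \<le> of_nat r * expected_time G L A t"
proof -
  have "ennreal (1 - 2 * p\<^sub>f) \<le> (\<Sum>i. expected_asks G L A t (D M) i)" if M: "M \<in> I" for M
  proof -
    define good where "good G = {x. \<not> \<bar>x - pagerank \<alpha> G t\<bar> \<ge> \<epsilon> * pagerank \<alpha> G t}" for G
    \<comment> \<open>Both error bounds are strict, so the non-strict gap between the two PageRanks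
      separates the good outputs.\<close>
    have "good G \<inter> good (G' M) = {}"
      using assms(11)[OF M] by (auto simp: good_def not_le abs_less_iff algebra_simps)
    then have "ennreal (output_prob G L A t (good G) + output_prob (G' M) (L' M) A t (good (G' M)) - 1)
      \<le> (\<Sum>i. expected_asks G L A t (D M) i)"
      using assms(9,10)[OF M] by (intro output_prob_perturbation) auto
    moreover have "1 - output_prob G L A t (good G) \<le> p\<^sub>f"
      using assms(1-4) by (auto simp: solves_single_node_def good_def)
    moreover have "1 - output_prob (G' M) (L' M) A t (good (G' M)) \<le> p\<^sub>f"
      using assms(1,4) assms(7-9)[OF M] unfolding solves_single_node_def good_def by blast
    ultimately show ?thesis
      by (elim order_trans[rotated]) (intro ennreal_leI, simp)
  qed
  then have "(\<Sum>M\<in>I. ennreal (1 - 2 * p\<^sub>f)) \<le> (\<Sum>M\<in>I. \<Sum>i. expected_asks G L A t (D M) i)"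
    by (intro sum_mono)
  also have "\<dots> \<le> of_nat r * expected_time G L A t"
    by (rule sum_expected_asks_le[OF assms(5,6)])
  finally show ?thesis by simp
qed

section \<open>Switching two arcs\<close>

definition switch_arcs :: "'a \<Rightarrow> 'a \<Rightarrow> 'a \<Rightarrow> 'a \<Rightarrow> 'a pair_pre_digraph \<Rightarrow> 'a pair_pre_digraph" where
  "switch_arcs z y u x G =
     \<lparr>pverts = pverts G, parcs = parcs G - {(z, y), (u, x)} \<union> {(z, x), (u, y)}\<rparr>"

text \<open>Renaming entries in place keeps all list lengths and the position of every other
  neighbour, so only the entries of the switched arcs change.\<close>

definition switch_lists :: "nat \<Rightarrow> nat \<Rightarrow> nat \<Rightarrow> nat \<Rightarrow> adj_lists \<Rightarrow> adj_lists" where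
  "switch_lists z y u x L =
     \<lparr>out_list = (\<lambda>v. if v \<in> {z, u} then map (Transposition.transpose x y) (out_list L v) else out_list L v),
      in_list = (\<lambda>v. if v \<in> {x, y} then map (Transposition.transpose z u) (in_list L v) else in_list L v),
      in_sorted_list = (\<lambda>v. if v \<in> {x, y} then map (Transposition.transpose z u) (in_sorted_list L v)
        else in_sorted_list L v)\<rparr>"

text \<open>The pair is read off the original lists. For an index out of range it is unspecified,
  which is harmless: the reply is then \<open>Invalid\<close> before and after the switch, and the
  later count holds for any pair.\<close>

fun probed_pair :: "adj_lists \<Rightarrow> query \<Rightarrow> (nat \<times> nat) option" where
  "probed_pair L (Out v i) = Some (v, out_list L v ! i)"
| "probed_pair L (In v i) = Some (in_list L v ! i, v)"
| "probed_pair L (In_Sorted v i) = Some (in_sorted_list L v ! i, v)"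
| "probed_pair L (Adj v w) = Some (v, w)"
| "probed_pair L _ = None"

lemma nth_answer_map_cong:
  "(i < length xs \<Longrightarrow> f (xs ! i) = xs ! i) \<Longrightarrow> nth_answer (map f xs) i = nth_answer xs i"
  by (simp add: nth_answer_def)

context
  fixes G :: "nat pair_pre_digraph" and z y u x :: nat
  assumes arcs: "(z, y) \<in> parcs G" "(u, x) \<in> parcs G" "(z, x) \<notin> parcs G" "(u, y) \<notin> parcs G"
begin

text \<open>Exactly one of \<open>x\<close>, \<open>y\<close> is an out-neighbour of
  \<open>z\<close>, and the other one of \<open>u\<close>, so the transposition exchanges them. As
  an injective image, the new neighbourhood has the old size.\<close>

lemma out_nbrs_switch_arcs:
  "out_nbrs (switch_arcs z y u x G) v =
    (if v \<in> {z, u} then Transposition.transpose x y ` out_nbrs G v else out_nbrs G v)"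
  using arcs
  by (auto simp: out_nbrs_def switch_arcs_def Transposition.transpose_def image_iff split: if_splits)

lemma in_nbrs_switch_arcs:
  "in_nbrs (switch_arcs z y u x G) v =
    (if v \<in> {x, y} then Transposition.transpose z u ` in_nbrs G v else in_nbrs G v)"
  using arcs
  by (auto simp: in_nbrs_def switch_arcs_def Transposition.transpose_def image_iff split: if_splits)

lemma out_degree_switch_arcs:
  "out_degree (with_proj (switch_arcs z y u x G)) v = out_degree (with_proj G) v"
  by (simp add: out_degree_eq_card_out_nbrs out_nbrs_switch_arcs card_image)

lemma in_degree_switch_arcs:
  "in_degree (with_proj (switch_arcs z y u x G)) v = in_degree (with_proj G) v"
  by (simp add: in_degree_eq_card_in_nbrs in_nbrs_switch_arcs card_image)

lemma walkable_switch_arcs: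
  assumes "walkable G"
  shows "walkable (switch_arcs z y u x G)"
proof -
  have G: "pair_fin_digraph G" using assms by (simp add: walkable_def)
  have "pair_fin_digraph (switch_arcs z y u x G)"
    using G arcs unfolding pair_fin_digraph_def pair_fin_digraph_axioms_def pair_wf_digraph_def
    by (force simp: switch_arcs_def)
  then show ?thesis
    using assms by (simp add: walkable_def out_degree_switch_arcs) (simp add: switch_arcs_def)
qed

text \<open>Sortedness survives because \<open>z\<close> and \<open>u\<close> have equal out-degree:
  exchanging them leaves the list of out-degrees unchanged.\<close>

lemma adj_lists_of_switch:
  assumes "adj_lists_of G L" "out_degree (with_proj G) z = out_degree (with_proj G) u"
  shows "adj_lists_of (switch_arcs z y u x G) (switch_lists z y u x L)"
proof -
  have deg: "out_degree (with_proj G) \<circ> Transposition.transpose z u = out_degree (with_proj G)"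
    using assms(2) by (auto simp: fun_eq_iff Transposition.transpose_def)
  show ?thesis
    unfolding adj_lists_of_def
  proof
    fix v assume "v \<in> pverts (switch_arcs z y u x G)"
    then have "v \<in> pverts G"
      by (simp add: switch_arcs_def)
    then have *: "distinct (out_list L v)" "set (out_list L v) = out_nbrs G v"
      "distinct (in_list L v)" "set (in_list L v) = in_nbrs G v"
      "distinct (in_sorted_list L v)" "set (in_sorted_list L v) = in_nbrs G v"
      "sorted (map (out_degree (with_proj G)) (in_sorted_list L v))"
      using assms(1) unfolding adj_lists_of_def by blast+
    let ?G = "switch_arcs z y u x G" and ?L = "switch_lists z y u x L"
    have "distinct (out_list ?L v)" "set (out_list ?L v) = out_nbrs ?G v"
      using *(1,2) by (simp_all add: switch_lists_def distinct_map out_nbrs_switch_arcs)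
    moreover have "distinct (in_list ?L v)" "set (in_list ?L v) = in_nbrs ?G v"
      using *(3,4) by (simp_all add: switch_lists_def distinct_map in_nbrs_switch_arcs)
    moreover have "distinct (in_sorted_list ?L v)" "set (in_sorted_list ?L v) = in_nbrs ?G v"
      using *(5,6) by (simp_all add: switch_lists_def distinct_map in_nbrs_switch_arcs)
    moreover have "sorted (map (out_degree (with_proj ?G)) (in_sorted_list ?L v))"
      unfolding out_degree_switch_arcs[THEN ext] using *(7) by (simp add: switch_lists_def deg)
    ultimately show "distinct (out_list ?L v) \<and> set (out_list ?L v) = out_nbrs ?G v \<and>
        distinct (in_list ?L v) \<and> set (in_list ?L v) = in_nbrs ?G v \<and>
        distinct (in_sorted_list ?L v) \<and> set (in_sorted_list ?L v) = in_nbrs ?G v \<and>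
        sorted (map (out_degree (with_proj ?G)) (in_sorted_list ?L v))"
      by blast
  qed
qed

text \<open>A list entry outside the four pairs is fixed by the transposition, and adjacency changes
  only on these pairs. Degrees and the node set are preserved.\<close>

lemma reply_switch:
  assumes "\<not> (\<exists>p\<in>{z, u} \<times> {x, y}. probed_pair L q = Some p)"
  shows "reply (switch_arcs z y u x G) (switch_lists z y u x L) q = reply G L q"
proof -
  have V: "pverts (switch_arcs z y u x G) = pverts G"
    by (simp add: switch_arcs_def)
  have *: "Transposition.transpose a b c = c" if "c \<noteq> a" "c \<noteq> b" for a b c :: nat
    using that by (rule transpose_apply_other)
  show ?thesis
  proof (cases q)
    case (Adj v w)
    then show ?thesis
      using assms by (auto simp: switch_arcs_def)
  qed (use assms in \<open>auto simp: V switch_lists_def out_degree_switch_arcs in_degree_switch_arcs *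
      intro!: nth_answer_map_cong\<close>)
qed

end

section \<open>The hard instance\<close>

text \<open>
  Group \<open>(a, b)\<close> consists of a hub with \<open>k\<close> spokes pointing to it and \<open>k\<close> targets below it. The leaves
  above the spokes and the heavy nodes both have out-degree \<open>e\<close>. Exclusive feeders give each heavy
  node its PageRank, and the padding only supplies the missing arcs. Nodes that should lead nowhere
  carry a loop, so that personalized PageRank is computed by finitely many first-step equations.
\<close>

datatype node =
    Target nat nat nat | Hub nat nat | Spoke nat nat nat | Leaf nat nat nat
  | Heavy nat | Sink nat nat | Feeder nat nat | Pad_Source nat | Pad_Sink nat

text \<open>Countability provides the injection \<open>to_nat\<close> that turns the symbolic nodes
  into the numbers required by the model.\<close>

instance node :: countable
  by countable_datatype

locale hard_instance =
  fixes k e F p :: nat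
  assumes e_pos: "0 < e" and e_le_k: "e \<le> k" and p_pos: "0 < p"
begin

definition nodes :: "node set" where
  "nodes =
     (\<lambda>(a, b, j). Target a b j) ` ({..<k} \<times> {..<e} \<times> {..<k}) \<union>
     (\<lambda>(a, b). Hub a b) ` ({..<k} \<times> {..<e}) \<union>
     (\<lambda>(a, b, i). Spoke a b i) ` ({..<k} \<times> {..<e} \<times> {..<k}) \<union>
     (\<lambda>(a, b, i). Leaf a b i) ` ({..<k} \<times> {..<e} \<times> {..<k}) \<union>
     Heavy ` {..<k} \<union>
     (\<lambda>(h, l). Sink h l) ` ({..<k} \<times> {..<e}) \<union>
     (\<lambda>(h, i). Feeder h i) ` ({..<k} \<times> {..<F}) \<union>
     Pad_Source ` {..<p} \<union> Pad_Sink ` {..<p}"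

text \<open>For fixed \<open>a\<close> and \<open>i\<close>, leaves and spokes form a complete
  bipartite graph with \<open>e\<close> nodes on each side. So \<open>k * e\<close> arcs enter the
  spokes of each group, although there are only \<open>k * e * k\<close> leaves for all
  \<open>k * e\<close> groups together.\<close>

fun succs :: "node \<Rightarrow> node set" where
  "succs (Target a b j) = {Target a b j}"
| "succs (Hub a b) = Target a b ` {..<k}"
| "succs (Spoke a b i) = {Hub a b}"
| "succs (Leaf a b i) = (\<lambda>b'. Spoke a b' i) ` {..<e}"
| "succs (Heavy h) = Sink h ` {..<e}"
| "succs (Sink h l) = {Sink h l}"
| "succs (Feeder h i) = {Heavy h}"
| "succs (Pad_Source i) = Pad_Sink ` {..<p}"
| "succs (Pad_Sink j) = {Pad_Sink j}"

definition graph :: "nat pair_pre_digraph" where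
  "graph = \<lparr>pverts = to_nat ` nodes, parcs = map_prod to_nat to_nat ` (SIGMA v:nodes. succs v)\<rparr>"

lemma k_pos: "0 < k"
  using e_pos e_le_k by simp

lemma nodes_iff [simp]:
  "Target a b j \<in> nodes \<longleftrightarrow> a < k \<and> b < e \<and> j < k"
  "Hub a b \<in> nodes \<longleftrightarrow> a < k \<and> b < e"
  "Spoke a b j \<in> nodes \<longleftrightarrow> a < k \<and> b < e \<and> j < k"
  "Leaf a b j \<in> nodes \<longleftrightarrow> a < k \<and> b < e \<and> j < k"
  "Heavy h \<in> nodes \<longleftrightarrow> h < k"
  "Sink h l \<in> nodes \<longleftrightarrow> h < k \<and> l < e"
  "Feeder h i \<in> nodes \<longleftrightarrow> h < k \<and> i < F"
  "Pad_Source i \<in> nodes \<longleftrightarrow> i < p"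
  "Pad_Sink i \<in> nodes \<longleftrightarrow> i < p"
  by (auto simp: nodes_def image_iff)

lemma finite_nodes: "finite nodes"
  by (simp add: nodes_def)

lemma succs_finite_nonempty:
  "finite (succs v)" "succs v \<noteq> {}"
  using e_pos k_pos p_pos by (cases v; auto)+

lemma succs_subset: "v \<in> nodes \<Longrightarrow> succs v \<subseteq> nodes"
  using e_pos k_pos p_pos by (cases v) auto

lemma sum_nodes:
  "(\<Sum>v\<in>nodes. f v) =
     (\<Sum>a<k. \<Sum>b<e. \<Sum>j<k. f (Target a b j)) + (\<Sum>a<k. \<Sum>b<e. f (Hub a b)) +
     (\<Sum>a<k. \<Sum>b<e. \<Sum>i<k. f (Spoke a b i)) + (\<Sum>a<k. \<Sum>b<e. \<Sum>i<k. f (Leaf a b i)) +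
     (\<Sum>h<k. f (Heavy h)) + (\<Sum>h<k. \<Sum>l<e. f (Sink h l)) + (\<Sum>h<k. \<Sum>i<F. f (Feeder h i)) +
     (\<Sum>i<p. f (Pad_Source i)) + (\<Sum>i<p. f (Pad_Sink i))"
  unfolding nodes_def
  by ((subst sum.union_disjoint; (force)?)+,
      simp add: sum.reindex inj_on_def sum.cartesian_product case_prod_unfold)

lemma out_nbrs_graph: "v \<in> nodes \<Longrightarrow> out_nbrs graph (to_nat v) = to_nat ` succs v"
  by (auto simp: out_nbrs_def graph_def image_iff)

lemma pverts_graph: "pverts graph = to_nat ` nodes"
  by (simp add: graph_def)

lemma parcs_graph_iff: "(to_nat v, to_nat w) \<in> parcs graph \<longleftrightarrow> v \<in> nodes \<and> w \<in> succs v"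
  by (auto simp: graph_def)

lemma card_out_nbrs_graph: "v \<in> nodes \<Longrightarrow> card (out_nbrs graph (to_nat v)) = card (succs v)"
  by (simp add: out_nbrs_graph card_image)

lemma walkable_graph: "walkable graph"
proof -
  have "pair_fin_digraph graph"
    by unfold_locales
      (auto simp: graph_def finite_nodes succs_finite_nonempty dest: succs_subset[THEN subsetD])
  moreover have "1 \<le> card (succs v)" for v
    using succs_finite_nonempty[of v] by (simp add: Suc_le_eq card_gt_0_iff)
  ultimately show ?thesis
    by (auto simp: walkable_def out_degree_eq_card_out_nbrs card_out_nbrs_graph pverts_graph)
qed

lemma card_pverts_graph:
  "card (pverts graph) = k * e * k + k * e + k * e * k + k * e * k + k + k * e + k * F + p + p"
proof -
  have "card (pverts graph) = (\<Sum>v\<in>nodes. 1)"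
    by (simp add: pverts_graph card_image)
  also have "\<dots> = k * e * k + k * e + k * e * k + k * e * k + k + k * e + k * F + p + p"
    unfolding sum_nodes by simp
  finally show ?thesis .
qed

lemma card_parcs_graph:
  "card (parcs graph) = k * e * k + k * e * k + k * e * k + k * e * k * e + k * e + k * e + k * F + p * p + p"
proof -
  have "card (parcs graph) = card (SIGMA v:nodes. succs v)"
    unfolding graph_def by (auto intro!: card_image simp: inj_on_def)
  also have "\<dots> = (\<Sum>v\<in>nodes. card (succs v))"
    by (simp add: finite_nodes succs_finite_nonempty)
  also have "\<dots> = k * e * k + k * e * k + k * e * k + k * e * k * e + k * e + k * e + k * F + p * p + p"
    unfolding sum_nodes by (simp add: card_image inj_on_def)
  finally show ?thesis .
qed

lemma sum_pverts: "(\<Sum>s\<in>to_nat ` nodes. f s) = (\<Sum>v\<in>nodes. f (to_nat v))"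
  by (simp add: sum.reindex)

section \<open>PageRank of a target before and after a switch\<close>

context
  fixes \<alpha> :: real and a b j :: nat
  assumes \<alpha>: "0 < \<alpha>" "\<alpha> < 1" and t: "a < k" "b < e" "j < k"
begin

abbreviation (input) "ppr_to v \<equiv> ppr \<alpha> graph (to_nat v) (to_nat (Target a b j))"

text \<open>Nested conditionals, here and below, let the sums over all nodes collapse one index at a
  time.\<close>

lemma ppr_Target: "a' < k \<Longrightarrow> b' < e \<Longrightarrow> j' < k \<Longrightarrow>
    ppr_to (Target a' b' j') = (if a' = a then if b' = b then if j' = j then 1 else 0 else 0 else 0)"
  using \<alpha> by (subst ppr_loop[OF walkable_graph]) (auto simp: pverts_graph out_nbrs_graph)

lemma ppr_Sink: "h < k \<Longrightarrow> l < e \<Longrightarrow> ppr_to (Sink h l) = 0"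
  using \<alpha> by (subst ppr_loop[OF walkable_graph]) (auto simp: pverts_graph out_nbrs_graph)

lemma ppr_Pad_Sink: "i < p \<Longrightarrow> ppr_to (Pad_Sink i) = 0"
  using \<alpha> by (subst ppr_loop[OF walkable_graph]) (auto simp: pverts_graph out_nbrs_graph)

text \<open>Before a switch a heavy node leads only to sinks, so its PageRank, however large, does
  not reach any target.\<close>

lemma ppr_Heavy: "h < k \<Longrightarrow> ppr_to (Heavy h) = 0"
  by (rule ppr_eq_0[OF walkable_graph _ \<alpha>]) (auto simp: pverts_graph out_nbrs_graph ppr_Sink)

lemma ppr_Feeder: "h < k \<Longrightarrow> i < F \<Longrightarrow> ppr_to (Feeder h i) = 0"
  by (rule ppr_eq_0[OF walkable_graph _ \<alpha>]) (auto simp: pverts_graph out_nbrs_graph ppr_Heavy)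

lemma ppr_Pad_Source: "i < p \<Longrightarrow> ppr_to (Pad_Source i) = 0"
  by (rule ppr_eq_0[OF walkable_graph _ \<alpha>]) (auto simp: pverts_graph out_nbrs_graph ppr_Pad_Sink)

lemma ppr_Hub:
  assumes "a' < k" "b' < e"
  shows "ppr_to (Hub a' b') = (if a' = a then if b' = b then (1 - \<alpha>) / k else 0 else 0)"
proof (cases "a' = a \<and> b' = b")
  case True
  then show ?thesis
    using \<alpha> t
    by (subst ppr_single_out_nbr[OF walkable_graph, where v = "to_nat (Target a b j)"])
      (auto simp: pverts_graph out_nbrs_graph ppr_Target card_image inj_on_def)
next
  case False
  have "ppr_to (Hub a' b') = 0"
    by (rule ppr_eq_0[OF walkable_graph _ \<alpha>])
      (use assms False in \<open>auto simp: pverts_graph out_nbrs_graph ppr_Target\<close>)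
  then show ?thesis using False by auto
qed

lemma ppr_Spoke:
  assumes "a' < k" "b' < e" "i < k"
  shows "ppr_to (Spoke a' b' i) = (if a' = a then if b' = b then (1 - \<alpha>)^2 / k else 0 else 0)"
  using \<alpha> t assms
  by (subst ppr_single_out_nbr[OF walkable_graph, where v = "to_nat (Hub a' b')"])
    (auto simp: pverts_graph out_nbrs_graph ppr_Hub power2_eq_square)

text \<open>Of the \<open>e\<close> spokes below the leaf only the one with second index
  \<open>b\<close> can lead to the target, hence the factor \<open>e\<close> and the independence of
  \<open>b'\<close>.\<close>

lemma ppr_Leaf:
  assumes "a' < k" "b' < e" "i < k"
  shows "ppr_to (Leaf a' b' i) = (if a' = a then (1 - \<alpha>)^3 / (k * e) else 0)"
  using \<alpha> t assms
  by (subst ppr_single_out_nbr[OF walkable_graph, where v = "to_nat (Spoke a' b i)"])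
    (auto simp: pverts_graph out_nbrs_graph ppr_Spoke card_image inj_on_def power3_eq_cube power2_eq_square)

lemma pagerank_graph_le: "pagerank \<alpha> graph (to_nat (Target a b j)) \<le> 4 / card (pverts graph)"
proof -
  have if_sum: "(\<Sum>i\<in>S. if P then g i else 0) = (if P then \<Sum>i\<in>S. g i else 0)"
    for S :: "nat set" and P and g :: "nat \<Rightarrow> real"
    by simp
  have mult_if: "c * (if P then d else 0) = (if P then c * d else 0)" for P and c d :: real
    by simp
  \<comment> \<open>The terms come from the target, its hub, its \<open>k\<close> spokes and the
    \<open>k * e\<close> leaves above these.\<close>
  have "(\<Sum>v\<in>nodes. ppr_to v) = 1 + (1 - \<alpha>) / k + (1 - \<alpha>)^2 + (1 - \<alpha>)^3"
    unfolding sum_nodes using t k_pos e_pos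
    by (simp add: ppr_Target ppr_Hub ppr_Spoke ppr_Leaf ppr_Heavy ppr_Sink ppr_Feeder ppr_Pad_Source
        ppr_Pad_Sink if_sum mult_if cong: sum.cong_simp)
  also have "\<dots> \<le> 1 + 1 + 1 + 1"
    using \<alpha> k_pos by (intro add_mono power_le_one) (auto simp: divide_simps)
  finally show ?thesis
    unfolding pagerank_def pverts_graph sum_pverts by (intro divide_right_mono) auto
qed

context
  fixes i b' h l :: nat
  assumes M: "i < k" "b' < e" "h < k" "l < e"
begin

abbreviation (input) "leaf \<equiv> to_nat (Leaf a b' i)"
abbreviation (input) "spoke \<equiv> to_nat (Spoke a b i)"
abbreviation (input) "heavy \<equiv> to_nat (Heavy h)"
abbreviation (input) "sink \<equiv> to_nat (Sink h l)"

lemma switchable: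
  "(leaf, spoke) \<in> parcs graph" "(heavy, sink) \<in> parcs graph" "(leaf, sink) \<notin> parcs graph" "(heavy, spoke) \<notin> parcs graph"
  using t M by (auto simp: parcs_graph_iff)

lemmas walkable_switch = walkable_switch_arcs[OF switchable walkable_graph]

lemma out_degree_switchable: "out_degree (with_proj graph) leaf = out_degree (with_proj graph) heavy"
  using t M by (simp add: out_degree_eq_card_out_nbrs card_out_nbrs_graph card_image inj_on_def)

text \<open>The switch opens the path feeder, heavy node, spoke, hub, target with out-degrees 1,
  \<open>e\<close>, 1, \<open>k\<close>. Each of the \<open>F\<close> feeders of \<open>h\<close>
  thus contributes at least \<open>(1 - \<alpha>)^4 / (e * k)\<close>.\<close>

lemma pagerank_switch_ge:
  "F * (1 - \<alpha>)^4 / (e * k) / card (pverts graph)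
    \<le> pagerank \<alpha> (switch_arcs leaf spoke heavy sink graph) (to_nat (Target a b j))"
proof -
  let ?G = "switch_arcs leaf spoke heavy sink graph"
  let ?f = "\<lambda>v. ppr \<alpha> ?G (to_nat v) (to_nat (Target a b j))"
  have V: "pverts ?G = to_nat ` nodes"
    by (simp add: switch_arcs_def pverts_graph)
  have nbr_le: "(1 - \<alpha>) * ?f w / card (succs v) \<le> ?f v"
    if "v \<in> nodes" "to_nat w \<in> out_nbrs ?G (to_nat v)" for v w :: node
  proof -
    have "card (out_nbrs ?G (to_nat v)) = card (succs v)"
      using that by (simp add: out_nbrs_switch_arcs[OF switchable] card_image card_out_nbrs_graph)
    then show ?thesis
      using ppr_ge_out_nbr[OF walkable_switch _ \<alpha> that(2), of "to_nat (Target a b j)"] that(1)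
      by (simp add: V)
  qed
  have "?f (Target a b j) = 1"
    using \<alpha> t by (subst ppr_loop[OF walkable_switch])
      (auto simp: V out_nbrs_switch_arcs[OF switchable] out_nbrs_graph)
  then have "(1 - \<alpha>) / k \<le> ?f (Hub a b)"
    using nbr_le[of "Hub a b" "Target a b j"] t
    by (simp add: out_nbrs_switch_arcs[OF switchable] out_nbrs_graph card_image inj_on_def)
  then have "(1 - \<alpha>) * ((1 - \<alpha>) / k) \<le> (1 - \<alpha>) * ?f (Hub a b)"
    using \<alpha> by (intro mult_left_mono) auto
  also have "\<dots> \<le> ?f (Spoke a b i)"
    using nbr_le[of "Spoke a b i" "Hub a b"] t M
    by (simp add: out_nbrs_switch_arcs[OF switchable] out_nbrs_graph)
  finally have "(1 - \<alpha>) * ((1 - \<alpha>) * ((1 - \<alpha>) / k)) / e \<le> (1 - \<alpha>) * ?f (Spoke a b i) / e"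
    using \<alpha> by (intro divide_right_mono mult_left_mono) auto
  also have "\<dots> \<le> ?f (Heavy h)"
  proof -
    \<comment> \<open>This element is \<open>spoke\<close>: the old arc to \<open>sink\<close> now
      ends there.\<close>
    have "Transposition.transpose sink spoke sink \<in> Transposition.transpose sink spoke ` to_nat ` Sink h ` {..<e}"
      using M by blast
    then show ?thesis
      using nbr_le[of "Heavy h" "Spoke a b i"] t M
      by (simp add: out_nbrs_switch_arcs[OF switchable] out_nbrs_graph card_image inj_on_def)
  qed
  finally have "(1 - \<alpha>) * ((1 - \<alpha>) * ((1 - \<alpha>) * ((1 - \<alpha>) / k)) / e) \<le> (1 - \<alpha>) * ?f (Heavy h)"
    using \<alpha> by (intro mult_left_mono) auto
  also have "\<dots> \<le> ?f (Feeder h i')" if "i' < F" for i'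
    using nbr_le[of "Feeder h i'" "Heavy h"] that M
    by (simp add: out_nbrs_switch_arcs[OF switchable] out_nbrs_graph)
  finally have feeder: "(1 - \<alpha>)^4 / (e * k) \<le> ?f (Feeder h i')" if "i' < F" for i'
    using that by (simp add: power4_eq_xxxx mult_ac)
  have "F * ((1 - \<alpha>)^4 / (e * k)) = (\<Sum>i'<F. (1 - \<alpha>)^4 / (e * k))"
    by simp
  also have "\<dots> \<le> (\<Sum>i'<F. ?f (Feeder h i'))"
    by (intro sum_mono feeder) simp
  also have "\<dots> = (\<Sum>v\<in>Feeder h ` {..<F}. ?f v)"
    by (simp add: sum.reindex inj_on_def)
  also have "\<dots> \<le> (\<Sum>v\<in>nodes. ?f v)"
    using M by (intro sum_mono2 finite_nodes) (auto simp: ppr_nonneg)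
  finally have "F * ((1 - \<alpha>)^4 / (e * k)) / card (to_nat ` nodes)
      \<le> (\<Sum>v\<in>nodes. ?f v) / card (to_nat ` nodes)"
    by (rule divide_right_mono) simp
  then show ?thesis
    unfolding pagerank_def V sum_pverts pverts_graph by simp
qed

end

end

section \<open>Counting switches per query and bounding the running time on the hard
  instance\<close>

lemma card_switches_probed_le:
  "card {(i, b', h, l) \<in> {..<k} \<times> {..<e} \<times> {..<k} \<times> {..<e}.
      \<exists>c\<in>{to_nat (Leaf a b' i), to_nat (Heavy h)} \<times> {to_nat (Sink h l), to_nat (Spoke a b i)}.
        P = Some c} \<le> 4 * (k * e)"
  (is "card ?S \<le> _")
proof -
  define I where "I = {..<k} \<times> {..<e} \<times> {..<k} \<times> {..<e}"
  \<comment> \<open>One set for each kind of probed pair. The pair fixes \<open>i\<close> and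
    \<open>b'\<close> in \<open>S1\<close>, \<open>h\<close> and \<open>l\<close> in
    \<open>S2\<close>, \<open>h\<close> and \<open>i\<close> in \<open>S3\<close>, and all four
    indices in \<open>S4\<close>; the free indices give the injections below.\<close>
  define S1 where "S1 = {(i, b', h, l) \<in> I. P = Some (to_nat (Leaf a b' i), to_nat (Spoke a b i))}"
  define S2 where "S2 = {(i, b', h, l) \<in> I. P = Some (to_nat (Heavy h), to_nat (Sink h l))}"
  define S3 where "S3 = {(i, b', h, l) \<in> I. P = Some (to_nat (Heavy h), to_nat (Spoke a b i))}"
  define S4 where "S4 = {(i, b', h, l) \<in> I. P = Some (to_nat (Leaf a b' i), to_nat (Sink h l))}"
  have S: "?S = S1 \<union> S2 \<union> S3 \<union> S4"
    by (auto simp: I_def S1_def S2_def S3_def S4_def)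
  have "card ?S \<le> card S1 + card S2 + card S3 + card S4"
    unfolding S using card_Un_le[of S1 S2] card_Un_le[of "S1 \<union> S2" S3] card_Un_le[of "S1 \<union> S2 \<union> S3" S4]
    by linarith
  moreover have "card S1 \<le> card ({..<k} \<times> {..<e})"
    by (rule card_inj_on_le[where f = "\<lambda>(i, b', h, l). (h, l)"])
      (auto simp: S1_def I_def inj_on_def)
  moreover have "card S2 \<le> card ({..<k} \<times> {..<e})"
    by (rule card_inj_on_le[where f = "\<lambda>(i, b', h, l). (i, b')"])
      (auto simp: S2_def I_def inj_on_def)
  \<comment> \<open>Adjacency queries between heavy nodes and spokes force \<open>e \<le> k\<close>, which caps the bound at \<open>n\<^bsup>2/3\<^esup>\<close>.\<close>
  moreover have "card S3 \<le> card ({..<e} \<times> {..<e})"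
    by (rule card_inj_on_le[where f = "\<lambda>(i, b', h, l). (b', l)"])
      (auto simp: S3_def I_def inj_on_def)
  moreover have "card S4 \<le> card ({..<k} \<times> {..<e})"
    by (rule card_inj_on_le[where f = "\<lambda>(i, b', h, l). (h, l)"])
      (auto simp: S4_def I_def inj_on_def)
  moreover have "e * e \<le> k * e"
    using e_le_k by simp
  ultimately show ?thesis
    unfolding card_cartesian_product card_lessThan by linarith
qed

text \<open>There are \<open>(k * e)^2\<close> switches and each query probes at most
  \<open>4 * (k * e)\<close> of them; the quotient gives the bound. The condition on
  \<open>F\<close> makes the PageRank after a switch beat the upper bound
  \<open>4 / card (pverts graph)\<close> by the factor
  \<open>(1 + \<epsilon>) / (1 - \<epsilon>)\<close>.\<close>

lemma expected_time_Target_ge: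
  fixes \<alpha> \<epsilon> p\<^sub>f :: real
  assumes "0 < \<alpha>" "\<alpha> < 1" "0 < \<epsilon>" "\<epsilon> < 1" "p\<^sub>f < 1 / 2"
    and F: "4 * (1 + \<epsilon>) \<le> (1 - \<epsilon>) * (F * (1 - \<alpha>)^4 / (e * k))"
    and A: "solves_single_node \<alpha> \<epsilon> p\<^sub>f A" and L: "adj_lists_of graph L"
    and t: "a < k" "b < e" "j < k"
  shows "ennreal (k * e * (1 - 2 * p\<^sub>f) / 4) \<le> expected_time graph L A (to_nat (Target a b j))"
proof -
  let ?t = "to_nat (Target a b j)"
  define I where "I = {..<k} \<times> {..<e} \<times> {..<k} \<times> {..<e}"
  define G' where "G' = (\<lambda>(i, b', h, l).
    switch_arcs (to_nat (Leaf a b' i)) (to_nat (Spoke a b i)) (to_nat (Heavy h)) (to_nat (Sink h l)) graph)"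
  define L' where "L' = (\<lambda>(i, b', h, l).
    switch_lists (to_nat (Leaf a b' i)) (to_nat (Spoke a b i)) (to_nat (Heavy h)) (to_nat (Sink h l)) L)"
  define D where "D = (\<lambda>(i, b', h, l). {q.
    \<exists>c\<in>{to_nat (Leaf a b' i), to_nat (Heavy h)} \<times> {to_nat (Sink h l), to_nat (Spoke a b i)}.
      probed_pair L q = Some c})"
  have "of_nat (card I) * ennreal (1 - 2 * p\<^sub>f) \<le> of_nat (4 * (k * e)) * expected_time graph L A ?t"
  proof (rule expected_time_ge_of_distinguishable[OF A walkable_graph L,
        where I = I and D = D and G' = G' and L' = L'])
    show "?t \<in> pverts graph"
      using t by (simp add: pverts_graph)
    show "finite I"
      by (simp add: I_def)
    show "card {M \<in> I. q \<in> D M} \<le> 4 * (k * e)" for q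
      by (rule order_trans[OF eq_refl card_switches_probed_le[of a b "probed_pair L q"]],
          rule arg_cong[where f = card]) (auto simp: I_def D_def)
  next
    fix M assume "M \<in> I"
    then obtain i b' h l where M: "M = (i, b', h, l)" "i < k" "b' < e" "h < k" "l < e"
      by (auto simp: I_def)
    note sw = switchable[OF assms(1,2) t M(2-)]
    show "walkable (G' M)"
      using walkable_switch_arcs[OF sw walkable_graph] by (simp add: M(1) G'_def)
    show "adj_lists_of (G' M) (L' M)"
      using adj_lists_of_switch[OF sw L out_degree_switchable[OF assms(1,2) t M(2-)]]
      by (simp add: M(1) G'_def L'_def)
    show V: "pverts (G' M) = pverts graph"
      by (simp add: M(1) G'_def switch_arcs_def)
    show "reply (G' M) (L' M) q = reply graph L q" if "q \<notin> D M" for q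
      using reply_switch[OF sw, of L q] that by (simp add: M(1) D_def G'_def L'_def)
    have "(1 + \<epsilon>) * pagerank \<alpha> graph ?t \<le> (1 + \<epsilon>) * (4 / card (pverts graph))"
      using pagerank_graph_le[OF assms(1,2) t] assms(3) by (intro mult_left_mono) auto
    also have "\<dots> = 4 * (1 + \<epsilon>) / card (pverts graph)"
      by simp
    also have "\<dots> \<le> (1 - \<epsilon>) * (F * (1 - \<alpha>)^4 / (e * k)) / card (pverts graph)"
      using F by (rule divide_right_mono) simp
    also have "\<dots> = (1 - \<epsilon>) * (F * (1 - \<alpha>)^4 / (e * k) / card (pverts graph))"
      by simp
    also have "\<dots> \<le> (1 - \<epsilon>) * pagerank \<alpha> (G' M) ?t"
      using pagerank_switch_ge[OF assms(1,2) t M(2-)] assms(4)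
      by (intro mult_left_mono) (auto simp: M(1) G'_def)
    finally show "(1 + \<epsilon>) * pagerank \<alpha> graph ?t \<le> (1 - \<epsilon>) * pagerank \<alpha> (G' M) ?t" .
  qed
  moreover have "of_nat (card I) * ennreal (1 - 2 * p\<^sub>f)
      = of_nat (4 * (k * e)) * ennreal (k * e * (1 - 2 * p\<^sub>f) / 4)"
    unfolding ennreal_of_nat_eq_real_of_nat ennreal_mult'[OF of_nat_0_le_iff, symmetric]
    by (simp add: I_def card_cartesian_product mult.assoc)
  ultimately have "of_nat (4 * (k * e)) * ennreal (k * e * (1 - 2 * p\<^sub>f) / 4)
      \<le> of_nat (4 * (k * e)) * expected_time graph L A ?t"
    by simp
  then show ?thesis
    using e_pos k_pos by (subst (asm) ennreal_mult_le_mult_iff) (simp_all del: of_nat_mult)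
qed

text \<open>Only the \<open>k * e * k\<close> target nodes are counted; all other nodes contribute
  at least 0.\<close>

lemma average_expected_time_ge:
  fixes \<alpha> \<epsilon> p\<^sub>f :: real
  assumes "0 < \<alpha>" "\<alpha> < 1" "0 < \<epsilon>" "\<epsilon> < 1" "p\<^sub>f < 1 / 2"
    and "4 * (1 + \<epsilon>) \<le> (1 - \<epsilon>) * (F * (1 - \<alpha>)^4 / (e * k))"
    and "solves_single_node \<alpha> \<epsilon> p\<^sub>f A" "adj_lists_of graph L"
  shows "ennreal (real (k * e * k) * (k * e * (1 - 2 * p\<^sub>f) / 4) / card (pverts graph))
    \<le> average_expected_time graph L A"
proof -
  define I where "I = {..<k} \<times> {..<e} \<times> {..<k}"
  define target where "target = (\<lambda>(a, b, j). to_nat (Target a b j))"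
  let ?N = "card (pverts graph)" and ?c = "k * e * (1 - 2 * p\<^sub>f) / 4"
  have N: "0 < ?N"
    using k_pos by (simp add: card_pverts_graph)
  have inj: "inj_on target I"
    by (auto simp: target_def inj_on_def)
  have sub: "target ` I \<subseteq> pverts graph"
    by (auto simp: target_def I_def pverts_graph)
  have "ennreal (real (k * e * k) * ?c) = of_nat (k * e * k) * ennreal ?c"
    by (subst ennreal_mult') (simp_all only: ennreal_of_nat_eq_real_of_nat of_nat_0_le_iff)
  also have "\<dots> = (\<Sum>M\<in>I. ennreal ?c)"
    by (simp add: I_def card_cartesian_product mult_ac)
  also have "\<dots> \<le> (\<Sum>M\<in>I. expected_time graph L A (target M))"
    using expected_time_Target_ge[OF assms]
    by (intro sum_mono) (auto simp: I_def target_def)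
  also have "\<dots> = (\<Sum>t\<in>target ` I. expected_time graph L A t)"
    by (simp add: sum.reindex[OF inj])
  also have "\<dots> \<le> (\<Sum>t\<in>pverts graph. expected_time graph L A t)"
    using finite_pverts[OF walkable_graph] sub by (intro sum_mono2) auto
  finally have "ennreal (real (k * e * k) * ?c) / of_nat ?N \<le> average_expected_time graph L A"
    unfolding average_expected_time_def by (rule divide_right_mono_ennreal)
  moreover have "ennreal (real (k * e * k) * ?c) / of_nat ?N = ennreal (real (k * e * k) * ?c / ?N)"
    unfolding ennreal_of_nat_eq_real_of_nat using N assms(5) by (intro divide_ennreal) auto
  ultimately show ?thesis
    by simp
qed

end

section \<open>Choice of the sizes\<close>

text \<open>Take \<open>e\<close> about the minimum of \<open>m / n\<close> and the cube root of
  \<open>n\<close>, and \<open>k\<close> about \<open>sqrt (n / e)\<close>. Then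
  \<open>(k * e)^2\<close> is about \<open>n * e\<close>, which is of order \<open>m\<close> in the
  first case and \<open>n powr (4 / 3)\<close> in the second.\<close>

lemma hard_instance_parameters:
  fixes n m :: nat
  assumes "0 < n" "n \<le> m" "m \<le> n\<^sup>2"
  obtains k e p :: nat where "0 < e" "e \<le> k" "0 < p" "k\<^sup>2 * e \<le> n" "n \<le> 4 * (k\<^sup>2 * e)"
    "n * e \<le> m" "p \<le> n" "m \<le> p\<^sup>2" "p\<^sup>2 \<le> 4 * m"
    "min (real m powr (1 / 2)) (real n powr (2 / 3)) \<le> 3 * (real k * real e)"
proof -
  define e where "e = (GREATEST e. n * e \<le> m \<and> e ^ 3 \<le> n)"
  have bound: "d \<le> m" if "n * d \<le> m \<and> d ^ 3 \<le> n" for d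
    using that \<open>0 < n\<close> le_trans[of d "n * d" m] by simp
  have one: "n * 1 \<le> m \<and> 1 ^ 3 \<le> n"
    using assms by simp
  have e: "n * e \<le> m" "e ^ 3 \<le> n"
    using GreatestI_nat[of "\<lambda>e. n * e \<le> m \<and> e ^ 3 \<le> n", OF one bound] by (auto simp: e_def)
  have max: "d \<le> e" if "n * d \<le> m \<and> d ^ 3 \<le> n" for d
    unfolding e_def by (rule Greatest_le_nat[of _ _ m]) (use that bound in auto)
  have "0 < e"
    using max[OF one] by simp
  define k where "k = floor_sqrt (n div e)"
  have k1: "k\<^sup>2 \<le> n div e"
    by (simp add: k_def)
  have k2: "n div e < (Suc k)\<^sup>2"
    unfolding k_def by (rule Suc_floor_sqrt_power2_gt)
  \<comment> \<open>The cubic constraint on \<open>e\<close> is what yields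
    \<open>e \<le> k\<close>.\<close>
  have "e\<^sup>2 \<le> n div e"
    using e(2) \<open>0 < e\<close> by (simp add: less_eq_div_iff_mult_less_eq power2_eq_square power3_eq_cube)
  then have "e \<le> k"
    by (simp add: k_def le_floor_sqrt_iff)
  have ke: "k\<^sup>2 * e \<le> n"
    using k1 \<open>0 < e\<close> by (simp add: less_eq_div_iff_mult_less_eq)
  have "n < (Suc k)\<^sup>2 * e"
    using k2 \<open>0 < e\<close> by (simp add: div_less_iff_less_mult)
  also have "\<dots> \<le> (2 * k)\<^sup>2 * e"
    using \<open>0 < e\<close> \<open>e \<le> k\<close> by (intro mult_le_mono power_mono) auto
  finally have n4: "n \<le> 4 * (k\<^sup>2 * e)"
    by (simp add: power_mult_distrib)
  \<comment> \<open>The complete bipartite padding has \<open>p^2\<close> arcs, enough for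
    \<open>m\<close>, and \<open>m \<le> n^2\<close> keeps \<open>p\<close> at most
    \<open>n\<close>.\<close>
  define p where "p = (LEAST p. m \<le> p\<^sup>2)"
  have p1: "m \<le> p\<^sup>2"
    unfolding p_def by (rule LeastI[of "\<lambda>p. m \<le> p\<^sup>2", OF assms(3)])
  have p2: "p \<le> n"
    unfolding p_def by (rule Least_le[of "\<lambda>p. m \<le> p\<^sup>2", OF assms(3)])
  have "0 < p"
    using p1 assms by (cases p) auto
  have p3: "p\<^sup>2 \<le> 4 * m"
  \<comment> \<open>Minimality bounds \<open>(p - 1)^2\<close> by \<open>m\<close>, and
    \<open>p \<le> 2 * (p - 1)\<close> needs \<open>p\<close> at least 2.\<close>
  proof (cases "p = 1")
    case False
    have "\<not> m \<le> (p - 1)\<^sup>2"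
      using not_less_Least[of "p - 1" "\<lambda>p. m \<le> p\<^sup>2"] \<open>0 < p\<close> by (simp add: p_def)
    moreover have "p\<^sup>2 \<le> (2 * (p - 1))\<^sup>2"
      using \<open>0 < p\<close> False by (intro power_mono) auto
    ultimately show ?thesis
      by (simp add: power_mult_distrib)
  qed (use assms in simp)
  have T: "real n * real e \<le> 4 * (real k * real e)\<^sup>2"
  proof -
    have "n * e \<le> 4 * (k\<^sup>2 * e) * e"
      using n4 by (rule mult_le_mono1)
    also have "\<dots> = 4 * (k * e)\<^sup>2"
      by (simp add: power2_eq_square)
    finally have "real (n * e) \<le> real (4 * (k * e)\<^sup>2)"
      by (rule of_nat_mono)
    then show ?thesis
      by simp
  qed
  \<comment> \<open>By maximality \<open>Suc e\<close> violates one of the two constraints on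
    \<open>e\<close>, and either violation bounds one side of the minimum.\<close>
  have "real m powr (1 / 2) \<le> 3 * (real k * real e) \<or> real n powr (2 / 3) \<le> 3 * (real k * real e)"
  proof (cases "n * Suc e \<le> m")
    case False
    moreover have "n * Suc e \<le> n * (2 * e)"
      using \<open>0 < e\<close> by (intro mult_le_mono2) simp
    ultimately have "real m \<le> real (n * (2 * e))"
      by (intro of_nat_mono) linarith
    also have "\<dots> = 2 * (real n * real e)"
      by simp
    also have "\<dots> \<le> 2 * (4 * (real k * real e)\<^sup>2)"
      using T by (rule mult_left_mono) simp
    also have "\<dots> \<le> (3 * (real k * real e))\<^sup>2"
      by (simp add: power_mult_distrib)
    finally have "sqrt (real m) \<le> 3 * (real k * real e)"
      by (intro real_le_lsqrt) auto
    then show ?thesis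
      by (simp add: powr_half_sqrt)
  next
    case True
    then have "\<not> Suc e ^ 3 \<le> n"
      using max[of "Suc e"] by auto
    moreover have "Suc e ^ 3 \<le> (2 * e) ^ 3"
      using \<open>0 < e\<close> by (intro power_mono) simp_all
    ultimately have "real n \<le> real ((2 * e) ^ 3)"
      by (intro of_nat_mono) simp
    \<comment> \<open>Sixth powers avoid fractional exponents: \<open>n^4\<close> is the sixth power
      of \<open>n powr (2 / 3)\<close>. The constants give \<open>8 * 4^3 = 512\<close>, below
      \<open>3^6 = 729\<close>.\<close>
    then have "real n ^ 3 * real n \<le> real n ^ 3 * (2 * real e) ^ 3"
      by (intro mult_left_mono) simp_all
    also have "\<dots> = 8 * (real n * real e) ^ 3"
      by (simp add: power_mult_distrib)
    also have "\<dots> \<le> 8 * (4 * (real k * real e)\<^sup>2) ^ 3"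
      using T by (intro mult_left_mono power_mono) simp_all
    also have "\<dots> \<le> (3 * (real k * real e)) ^ 6"
      by (simp add: power_mult_distrib flip: power_mult)
    finally have "real n ^ 4 \<le> (3 * (real k * real e)) ^ 6"
      by (simp add: numeral_eq_Suc mult_ac)
    moreover have "(real n powr (2 / 3)) ^ 6 = real n ^ 4"
      using \<open>0 < n\<close> by (simp add: powr_power powr_numeral)
    ultimately have "(real n powr (2 / 3)) ^ 6 \<le> (3 * (real k * real e)) ^ 6"
      by (simp only:)
    then have "real n powr (2 / 3) \<le> 3 * (real k * real e)"
      by (subst (asm) power_mono_iff) simp_all
    then show ?thesis by simp
  qed
  then have "min (real m powr (1 / 2)) (real n powr (2 / 3)) \<le> 3 * (real k * real e)"
    by linarith
  with that \<open>0 < e\<close> \<open>e \<le> k\<close> \<open>0 < p\<close> ke n4 e(1) p2 p1 p3 show ?thesis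
    by blast
qed

theorem theorem6p9:
  fixes \<alpha> \<epsilon> p\<^sub>f :: real
  assumes "0 < \<alpha>" "\<alpha> < 1"
    and "0 < \<epsilon>" "\<epsilon> < 1"
    and "0 < p\<^sub>f" "p\<^sub>f < 1 / 2"
  shows "\<exists>a b c :: real. 0 < a \<and> 0 < b \<and> 0 < c \<and>
    (\<forall>n m :: nat. n \<le> m \<and> m \<le> n ^ 2 \<longrightarrow>
      (\<exists>G :: nat pair_pre_digraph.
        walkable G \<and>
        a * real n \<le> real (card (pverts G)) \<and> real (card (pverts G)) \<le> b * real n \<and>
        a * real m \<le> real (card (parcs G)) \<and> real (card (parcs G)) \<le> b * real m \<and>
        (\<forall>A L. solves_single_node \<alpha> \<epsilon> p\<^sub>f A \<and> adj_lists_of G L \<longrightarrow>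
           average_expected_time G L A
             \<ge> ennreal (c * min (real m powr (1 / 2)) (real n powr (2 / 3))))))"
proof -
  obtain C :: nat where C: "4 * (1 + \<epsilon>) / ((1 - \<epsilon>) * (1 - \<alpha>)^4) \<le> C"
    using real_arch_simple by blast
  \<comment> \<open>\<open>14 + C\<close> is the sum of the coefficients in the arc count and also
    covers the node count. In \<open>c\<close>, 48 is 3 from the choice of sizes, 4 from
    \<open>n \<le> 4 * (k^2 * e)\<close> and 4 from the probes per query.\<close>
  define a b c where "a = (1 / 4 :: real)" and "b = real (14 + C)"
    and "c = (1 - 2 * p\<^sub>f) / (48 * b)"
  have "0 < b" "0 < c"
    using assms by (simp_all add: b_def c_def)
  moreover have "\<exists>G :: nat pair_pre_digraph.
        walkable G \<and>
        a * real n \<le> real (card (pverts G)) \<and> real (card (pverts G)) \<le> b * real n \<and>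
        a * real m \<le> real (card (parcs G)) \<and> real (card (parcs G)) \<le> b * real m \<and>
        (\<forall>A L. solves_single_node \<alpha> \<epsilon> p\<^sub>f A \<and> adj_lists_of G L \<longrightarrow>
           average_expected_time G L A
             \<ge> ennreal (c * min (real m powr (1 / 2)) (real n powr (2 / 3))))"
    if nm: "n \<le> m" "m \<le> n ^ 2" for n m
  proof (cases "n = 0")
    \<comment> \<open>Here \<open>m = 0\<close> too, and the empty graph satisfies all bounds
      because the minimum is 0.\<close>
    case True
    define G :: "nat pair_pre_digraph" where "G = \<lparr>pverts = {}, parcs = {}\<rparr>"
    have "walkable G"
      unfolding walkable_def by (auto simp: G_def intro!: pair_fin_digraph.intro
          pair_wf_digraph.intro pair_fin_digraph_axioms.intro)
    then show ?thesis
      using True nm by (intro exI[of _ G]) (simp add: G_def)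
  next
    case False
    obtain k e p :: nat where kep: "0 < e" "e \<le> k" "0 < p" "k\<^sup>2 * e \<le> n" "n \<le> 4 * (k\<^sup>2 * e)"
      "n * e \<le> m" "p \<le> n" "m \<le> p\<^sup>2" "p\<^sup>2 \<le> 4 * m"
      "min (real m powr (1 / 2)) (real n powr (2 / 3)) \<le> 3 * (real k * real e)"
      by (rule hard_instance_parameters[of n m, OF _ nm that]) (use False in simp)
    \<comment> \<open>Then \<open>F / (e * k) = C\<close> gives the required PageRank gap, while all
      feeders together number \<open>C * (k^2 * e)\<close>, linear in \<open>n\<close>.\<close>
    define F where "F = C * e * k"
    interpret hard_instance k e F p
      using kep by unfold_locales
    let ?N = "card (pverts graph)"
    have small: "k * e \<le> k\<^sup>2 * e" "k \<le> k\<^sup>2 * e" "k * F = C * (k\<^sup>2 * e)" "k\<^sup>2 * e \<le> k\<^sup>2 * e * e"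
      "p \<le> p\<^sup>2"
      using kep k_pos by (auto simp: F_def power2_eq_square)
    have N: "n \<le> 4 * ?N" "?N \<le> (14 + C) * n"
    proof -
      have eq: "?N = 3 * (k\<^sup>2 * e) + 2 * (k * e) + k + C * (k\<^sup>2 * e) + 2 * p"
        by (simp add: card_pverts_graph small(3) power2_eq_square)
      show "n \<le> 4 * ?N"
        unfolding eq using kep(5) by simp
      have "?N \<le> 6 * (k\<^sup>2 * e) + C * (k\<^sup>2 * e) + 2 * p"
        unfolding eq using small(1,2) by linarith
      also have "\<dots> \<le> 6 * n + C * n + 2 * n"
        using kep(4,7) by (intro add_mono mult_le_mono2)
      also have "\<dots> \<le> (14 + C) * n"
        by (simp add: algebra_simps)
      finally show "?N \<le> (14 + C) * n" .
    qed
    have M: "m \<le> card (parcs graph)" "card (parcs graph) \<le> (14 + C) * m"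
    proof -
      have eq: "card (parcs graph)
          = 3 * (k\<^sup>2 * e) + k\<^sup>2 * e * e + 2 * (k * e) + C * (k\<^sup>2 * e) + p\<^sup>2 + p"
        by (simp add: card_parcs_graph small(3) power2_eq_square)
      show "m \<le> card (parcs graph)"
        unfolding eq using kep(8) by simp
      have "k\<^sup>2 * e * e \<le> m"
        using mult_le_mono1[OF kep(4), of e] kep(6) by (rule le_trans)
      then have "k\<^sup>2 * e \<le> m" "k * e \<le> m" "k\<^sup>2 * e * e \<le> m" "p\<^sup>2 \<le> 4 * m" "p \<le> 4 * m"
        using small kep(9) by linarith+
      then have "card (parcs graph) \<le> 3 * m + m + 2 * m + C * m + 4 * m + 4 * m"
        unfolding eq by (intro add_mono mult_le_mono2)
      then show "card (parcs graph) \<le> (14 + C) * m"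
        by (simp add: algebra_simps)
    qed
    have "(1 - \<epsilon>) * (F * (1 - \<alpha>)^4 / (e * k)) = (1 - \<epsilon>) * (1 - \<alpha>)^4 * C"
      using kep k_pos by (simp add: F_def)
    moreover have "4 * (1 + \<epsilon>) \<le> (1 - \<epsilon>) * (1 - \<alpha>)^4 * C"
      using C assms by (simp add: divide_le_eq mult_ac)
    ultimately have F: "4 * (1 + \<epsilon>) \<le> (1 - \<epsilon>) * (F * (1 - \<alpha>)^4 / (e * k))"
      by simp
    have "c * min (real m powr (1 / 2)) (real n powr (2 / 3))
        \<le> real (k * e * k) * (k * e * (1 - 2 * p\<^sub>f) / 4) / ?N"
    proof -
      let ?T = "real k * real e"
      have N_pos: "0 < real ?N"
        using N(1) False by simp
      have "real ?N \<le> b * n"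
        using of_nat_mono[OF N(2), where 'a = real] by (simp add: b_def)
      also have "\<dots> \<le> b * real (4 * (k\<^sup>2 * e))"
        using kep(5) \<open>0 < b\<close> by (intro mult_left_mono of_nat_mono) auto
      finally have "real ?N \<le> 4 * b * real (k * e * k)"
        by (simp add: power2_eq_square mult_ac)
      \<comment> \<open>The targets make up at least this constant fraction of all nodes.\<close>
      then have "1 / (4 * b) \<le> real (k * e * k) / ?N"
        using N_pos \<open>0 < b\<close> by (simp add: field_simps)
      then have "1 / (4 * b) * (?T * (1 - 2 * p\<^sub>f) / 4) \<le> real (k * e * k) / ?N * (?T * (1 - 2 * p\<^sub>f) / 4)"
        using assms by (intro mult_right_mono) auto
      moreover have "c * min (real m powr (1 / 2)) (real n powr (2 / 3)) \<le> c * (3 * ?T)"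
        using kep(10) \<open>0 < c\<close> by (intro mult_left_mono) auto
      moreover have "c * (3 * ?T) = 1 / (4 * b) * (?T * (1 - 2 * p\<^sub>f) / 4)"
        by (simp add: c_def)
      ultimately show ?thesis
        by simp
    qed
    then have "ennreal (c * min (real m powr (1 / 2)) (real n powr (2 / 3)))
        \<le> average_expected_time graph L A"
      if "solves_single_node \<alpha> \<epsilon> p\<^sub>f A" "adj_lists_of graph L" for A L
      using average_expected_time_ge[OF assms(1-4,6) F that] by (meson ennreal_leI order_trans)
    moreover have "a * real n \<le> real ?N" "real ?N \<le> b * real n"
      using of_nat_mono[OF N(1), where 'a = real] of_nat_mono[OF N(2), where 'a = real]
      by (simp_all add: a_def b_def)
    moreover have "a * real m \<le> real (card (parcs graph))" "real (card (parcs graph)) \<le> b * real m"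
      using of_nat_mono[OF M(1), where 'a = real] of_nat_mono[OF M(2), where 'a = real]
      by (simp_all add: a_def b_def)
    ultimately show ?thesis
      using walkable_graph by blast
  qed
  moreover have "0 < a"
    by (simp add: a_def)
  ultimately show ?thesis
    by blast
qed

end
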